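(* Let $s>0$ be fixed, let $k\ge1$ be an integer, and let $\{\mathbf{u}^n\}_{n\in\mathbb{N}}$ be the sequence generated by the BDF-$k$ accelerated gradient algorithm described in the context. Then $\dot{\mathbf{u}}^n$ converges strongly to $\mathbf{0}$ in $U$ as $n\to\infty$. If $2\le k\le4$, there exist $\mathbf{u}^*\in U$ and a subsequence of $\{\mathbf{u}^n\}$ converging weakly to $\mathbf{u}^*$ in $U$.
   Context: Setting. $\Omega\subset\mathbb{R}^d$ is a bounded Lipschitz domain; $U$ is a real Hilbert space of functions $\Omega\to\mathbb{R}^m$ continuously embedded in $H^1(\Omega;\mathbb{R}^m)$; $U_D\subset U$ is the set of functions satisfying given Dirichlet conditions on $\Gamma_D\subset\partial\Omega$ and $U_0\subset U$ is the closed linear subspace of functions satisfying the corresponding homogeneous conditions. $Z$ is a normed function space on $\Omega$, $B:U\times U\to Z$ is symmetric bilinear with $\|B(\mathbf{v},\mathbf{v})\|_Z\le c_Z\|\mathbf{v}\|_U^2$, and $\mathbf{u}_c\in Z$. $\mathcal{M}:U\times U\to\mathbb{R}$ is symmetric bilinear with $\mathcal{M}(\mathbf{v},\mathbf{v})\ge C_1\|\mathbf{v}\|_U^2$ and $\mathcal{M}(\mathbf{v},\mathbf{w})\le C_2\|\mathbf{v}\|_U\|\mathbf{w}\|_U$ on $U$ ($C_1,C_2>0$). $\mathcal{A}=\{\mathbf{u}\in U_D:B(\mathbf{u},\mathbf{u})=\mathbf{u}_c\}$ and $\mathcal{F}_{\mathbf{u}}=\{\mathbf{v}\in U_0:B(\mathbf{u},\mathbf{v})=0\}$.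 BDF-$k$ formulas. $\delta_0=\sum_{r=1}^k\frac1r$, $\delta_i=\frac{(-1)^i}{i}\binom{k}{i}$ ($1\le i\le k$), $\gamma_j=(-1)^j\binom{k}{j+1}$ and $\tilde\delta_j=\sum_{\ell=0}^j\delta_\ell$ ($0\le j\le k-1$); $$\dot{\mathbf{u}}^n=\frac1s\sum_{j=0}^k\delta_j\mathbf{u}^{n-j},\quad\hat{\mathbf{u}}^n=\sum_{j=0}^{k-1}\gamma_j\mathbf{u}^{n-j-1},\quad\widetilde{\mathbf{u}}^n=\sum_{j=0}^{k-1}\tilde\delta_j\mathbf{u}^{n-j},$$ with the convention $\mathbf{u}^{-1}:=\mathbf{u}^0$ (zero initial velocity). Algorithm (infinite sequence, no stopping). Fix $\alpha\ge3$, $s>0$, $t_n=ns$, $\mathbf{u}^0\in\mathcal{A}$. The BDF-$k$ step at index $n$ determines $\mathbf{u}^n$ from $\mathbf{u}^{n-1},\dots,\mathbf{u}^{n-k-1}$ by requiring $\dot{\mathbf{u}}^n\in\mathcal{F}_{\hat{\mathbf{u}}^n}$ and $$\Big(\tfrac{\dot{\mathbf{u}}^n-\dot{\mathbf{u}}^{n-1}}{s},\mathbf{w}\Big)_U+\tfrac{\alpha}{t_n}(\dot{\mathbf{u}}^n,\mathbf{w})_U+\mathcal{M}(\widetilde{\mathbf{u}}^n,\mathbf{w})=0\quad\text{for all }\mathbf{w}\in\mathcal{F}_{\hat{\mathbf{u}}^n},$$ all quantities being given by the BDF-$k$ formulas. The initial values $\mathbf{u}^1,\dots,\mathbf{u}^{k-1}$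 are computed successively by the BDF-$p$ step at index $n=p$ (same equations with $k$ replaced by $p$), $p=1,\dots,k-1$; for $n\ge k$ the BDF-$k$ step is used. *)

theory Defs
  imports "HOL-Analysis.Analysis"
begin

text \<open>Bounded Lipschitz domains: near each boundary point, and in a suitable rotated
  coordinate system with vertical axis \<open>\<nu>\<close>, the set is the strict subgraph of a Lipschitz
  function \<open>g\<close> on the hyperplane orthogonal to \<open>\<nu>\<close>.\<close>

definition lipschitz_boundary :: "'a::euclidean_space set \<Rightarrow> bool" where
  "lipschitz_boundary \<Omega> \<longleftrightarrow>
     (\<forall>x\<in>frontier \<Omega>. \<exists>r>0. \<exists>\<nu> g L. norm \<nu> = 1 \<and> L-lipschitz_on {z. z \<bullet> \<nu> = 0} (g :: 'a \<Rightarrow> real) \<and>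
        \<Omega> \<inter> ball x r = {y \<in> ball x r. y \<bullet> \<nu> < g (y - (y \<bullet> \<nu>) *\<^sub>R \<nu>)})"

definition bounded_lipschitz_domain :: "'a::euclidean_space set \<Rightarrow> bool" where
  "bounded_lipschitz_domain \<Omega> \<longleftrightarrow>
     open \<Omega> \<and> connected \<Omega> \<and> \<Omega> \<noteq> {} \<and> bounded \<Omega> \<and> lipschitz_boundary \<Omega>"

primrec Ck_fun :: "nat \<Rightarrow> ('a::euclidean_space \<Rightarrow> real) \<Rightarrow> bool" where
  "Ck_fun 0 f = continuous_on UNIV f"
| "Ck_fun (Suc k) f = ((\<forall>x. f differentiable (at x)) \<and>
     (\<forall>b\<in>Basis. Ck_fun k (\<lambda>x. frechet_derivative f (at x) b)))"

definition test_function :: "'a::euclidean_space set \<Rightarrow> ('a \<Rightarrow> real) \<Rightarrow> bool" where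
  "test_function \<Omega> \<phi> \<longleftrightarrow> (\<forall>k. Ck_fun k \<phi>) \<and>
     compact (closure {x. \<phi> x \<noteq> 0}) \<and> closure {x. \<phi> x \<noteq> 0} \<subseteq> \<Omega>"

definition in_L2 :: "'a::euclidean_space set \<Rightarrow> ('a \<Rightarrow> 'b::euclidean_space) \<Rightarrow> bool" where
  "in_L2 \<Omega> f \<longleftrightarrow> f \<in> borel_measurable (lebesgue_on \<Omega>) \<and>
     integrable (lebesgue_on \<Omega>) (\<lambda>x. (norm (f x))\<^sup>2)"

definition is_weak_partial ::
  "'a::euclidean_space set \<Rightarrow> 'a \<Rightarrow> ('a \<Rightarrow> 'b::euclidean_space) \<Rightarrow> ('a \<Rightarrow> 'b) \<Rightarrow> bool" where
  "is_weak_partial \<Omega> b f g \<longleftrightarrow> in_L2 \<Omega> g \<and>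
     (\<forall>\<phi>. test_function \<Omega> \<phi> \<longrightarrow>
        (\<integral>x. frechet_derivative \<phi> (at x) b *\<^sub>R f x \<partial>lebesgue_on \<Omega>)
          = - (\<integral>x. \<phi> x *\<^sub>R g x \<partial>lebesgue_on \<Omega>))"

definition weak_partial ::
  "'a::euclidean_space set \<Rightarrow> 'a \<Rightarrow> ('a \<Rightarrow> 'b::euclidean_space) \<Rightarrow> 'a \<Rightarrow> 'b" where
  "weak_partial \<Omega> b f = (SOME g. is_weak_partial \<Omega> b f g)"

definition in_H1 :: "'a::euclidean_space set \<Rightarrow> ('a \<Rightarrow> 'b::euclidean_space) \<Rightarrow> bool" where
  "in_H1 \<Omega> f \<longleftrightarrow> in_L2 \<Omega> f \<and> (\<forall>b\<in>Basis. \<exists>g. is_weak_partial \<Omega> b f g)"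

definition H1_norm :: "'a::euclidean_space set \<Rightarrow> ('a \<Rightarrow> 'b::euclidean_space) \<Rightarrow> real" where
  "H1_norm \<Omega> f = sqrt ((\<integral>x. (norm (f x))\<^sup>2 \<partial>lebesgue_on \<Omega>) +
     (\<Sum>b\<in>Basis. \<integral>x. (norm (weak_partial \<Omega> b f x))\<^sup>2 \<partial>lebesgue_on \<Omega>))"

text \<open>A normed or Hilbert space of functions on \<open>\<Omega>\<close> is given as a type \<open>'v\<close> carrying the norm,
  together with a map \<open>ev\<close> choosing for each element a representative. The representative is
  linear in the element, and determines it, up to null sets.\<close>

definition function_space_on ::
  "'a::euclidean_space set \<Rightarrow> ('v::real_vector \<Rightarrow> 'a \<Rightarrow> 'b::euclidean_space) \<Rightarrow> bool" where
  "function_space_on \<Omega> ev \<longleftrightarrow>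
     (\<forall>v. ev v \<in> borel_measurable (lebesgue_on \<Omega>)) \<and>
     (\<forall>v w. AE x in lebesgue_on \<Omega>. ev (v + w) x = ev v x + ev w x) \<and>
     (\<forall>c v. AE x in lebesgue_on \<Omega>. ev (c *\<^sub>R v) x = c *\<^sub>R ev v x) \<and>
     (\<forall>v. (AE x in lebesgue_on \<Omega>. ev v x = 0) \<longrightarrow> v = 0)"

definition continuously_embedded_H1 ::
  "'a::euclidean_space set \<Rightarrow> ('v::real_normed_vector \<Rightarrow> 'a \<Rightarrow> 'b::euclidean_space) \<Rightarrow> bool" where
  "continuously_embedded_H1 \<Omega> ev \<longleftrightarrow>
     (\<exists>C. \<forall>v. in_H1 \<Omega> (ev v) \<and> H1_norm \<Omega> (ev v) \<le> C * norm v)"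

text \<open>Dirichlet conditions on \<open>\<Gamma>\<close> have the form \<open>T v = g\<close> for a continuous linear boundary
  operator \<open>T\<close>. Nothing is assumed about \<open>T\<close> except that it only sees \<open>v\<close> near \<open>\<Gamma>\<close>, so traces of
  \<open>v\<close> and, for spaces of higher regularity, of its derivatives are all covered.\<close>

definition dirichlet_operator ::
  "'a::euclidean_space set \<Rightarrow> 'a set \<Rightarrow> ('v::real_normed_vector \<Rightarrow> 'a \<Rightarrow> 'b::euclidean_space) \<Rightarrow>
   ('v \<Rightarrow> 'g::real_normed_vector) \<Rightarrow> bool" where
  "dirichlet_operator \<Omega> \<Gamma> ev T \<longleftrightarrow> bounded_linear T \<and>
     (\<forall>v N. open N \<and> \<Gamma> \<subseteq> N \<and> (AE x in lebesgue_on (\<Omega> \<inter> N). ev v x = 0) \<longrightarrow> T v = 0)"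

definition admissible :: "'u set \<Rightarrow> ('u \<Rightarrow> 'u \<Rightarrow> 'z) \<Rightarrow> 'z \<Rightarrow> 'u set" where
  "admissible UD B uc = {u \<in> UD. B u u = uc}"

definition tangent_space :: "'u set \<Rightarrow> ('u \<Rightarrow> 'u \<Rightarrow> 'z::zero) \<Rightarrow> 'u \<Rightarrow> 'u set" where
  "tangent_space U0 B u = {v \<in> U0. B u v = 0}"

definition bdf_delta :: "nat \<Rightarrow> nat \<Rightarrow> real" where
  "bdf_delta k i = (if i = 0 then (\<Sum>r=1..k. 1 / real r)
                    else (-1) ^ i / real i * real (k choose i))"

definition bdf_gamma :: "nat \<Rightarrow> nat \<Rightarrow> real" where
  "bdf_gamma k j = (-1) ^ j * real (k choose (j + 1))"

definition bdf_delta_tilde :: "nat \<Rightarrow> nat \<Rightarrow> real" where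
  "bdf_delta_tilde k j = (\<Sum>l\<le>j. bdf_delta k l)"

text \<open>Subtraction of indices is truncated, so \<open>u (n - j)\<close> is \<open>u 0\<close> whenever \<open>j \<ge> n\<close>.
  This encodes \<open>u\<^sup>-\<^sup>1 := u\<^sup>0\<close>: the steps below only refer to indices \<open>\<ge> -1\<close>.\<close>

definition bdf_dot :: "nat \<Rightarrow> real \<Rightarrow> (nat \<Rightarrow> 'u::real_vector) \<Rightarrow> nat \<Rightarrow> 'u" where
  "bdf_dot k s u n = (1 / s) *\<^sub>R (\<Sum>j=0..k. bdf_delta k j *\<^sub>R u (n - j))"

definition bdf_hat :: "nat \<Rightarrow> (nat \<Rightarrow> 'u::real_vector) \<Rightarrow> nat \<Rightarrow> 'u" where
  "bdf_hat k u n = (\<Sum>j<k. bdf_gamma k j *\<^sub>R u (n - j - 1))"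

definition bdf_tilde :: "nat \<Rightarrow> (nat \<Rightarrow> 'u::real_vector) \<Rightarrow> nat \<Rightarrow> 'u" where
  "bdf_tilde k u n = (\<Sum>j<k. bdf_delta_tilde k j *\<^sub>R u (n - j))"

definition bdf_step ::
  "'u set \<Rightarrow> ('u \<Rightarrow> 'u \<Rightarrow> 'z::zero) \<Rightarrow> ('u \<Rightarrow> 'u \<Rightarrow> real) \<Rightarrow> real \<Rightarrow> real \<Rightarrow> nat \<Rightarrow>
   (nat \<Rightarrow> 'u::real_inner) \<Rightarrow> nat \<Rightarrow> bool" where
  "bdf_step U0 B M \<alpha> s k u n \<longleftrightarrow>
     bdf_dot k s u n \<in> tangent_space U0 B (bdf_hat k u n) \<and>
     (\<forall>w \<in> tangent_space U0 B (bdf_hat k u n).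
        ((1 / s) *\<^sub>R (bdf_dot k s u n - bdf_dot k s u (n - 1))) \<bullet> w
        + \<alpha> / (real n * s) * (bdf_dot k s u n \<bullet> w)
        + M (bdf_tilde k u n) w = 0)"

definition bdf_sequence ::
  "'u set \<Rightarrow> 'u set \<Rightarrow> ('u \<Rightarrow> 'u \<Rightarrow> 'z::zero) \<Rightarrow> 'z \<Rightarrow> ('u \<Rightarrow> 'u \<Rightarrow> real) \<Rightarrow> real \<Rightarrow> real \<Rightarrow> nat \<Rightarrow>
   (nat \<Rightarrow> 'u::real_inner) \<Rightarrow> bool" where
  "bdf_sequence UD U0 B uc M \<alpha> s k u \<longleftrightarrow>
     u 0 \<in> admissible UD B uc \<and>
     (\<forall>p\<in>{1..<k}. bdf_step U0 B M \<alpha> s p u p) \<and>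
     (\<forall>n\<ge>k. bdf_step U0 B M \<alpha> s k u n)"

definition weakly_converges :: "(nat \<Rightarrow> 'u::real_normed_vector) \<Rightarrow> 'u \<Rightarrow> bool" where
  "weakly_converges x l \<longleftrightarrow>
     (\<forall>f :: 'u \<Rightarrow> real. bounded_linear f \<longrightarrow> (\<lambda>n. f (x n)) \<longlonglongrightarrow> f l)"

end

theory Submission
  imports Defs "HOL-Complex_Analysis.Great_Picard"
begin

text \<open>Since the coefficients \<open>\<delta>\<^sub>j\<close> sum to zero, summation by parts identifies the increment of the
  averages \<open>bdf_tilde\<close> with \<open>s\<close> times \<open>bdf_dot\<close>. Testing the step with \<open>bdf_dot\<close> itself therefore
  makes the energy \<open>\<parallel>bdf_dot\<parallel>\<^sup>2 + M bdf_tilde bdf_tilde\<close> decay by at least \<open>C\<^sub>1 s\<^sup>2 \<parallel>bdf_dot\<parallel>\<^sup>2\<close> per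
  step, so \<open>\<parallel>bdf_dot\<parallel>\<^sup>2\<close> is summable and \<open>bdf_tilde\<close> stays bounded. For \<open>2 \<le> k \<le> 4\<close> the linear
  recursion expressing \<open>u\<close> through \<open>bdf_tilde\<close> is contractive, which bounds the iterates, and
  weak compactness of balls in Hilbert space yields the subsequence.\<close>

section \<open>Weak sequential compactness in Hilbert spaces\<close>

text \<open>The distances from the origin to the nested sets increase and stay bounded, so they
  converge. Points of nearly minimal norm then form a Cauchy sequence by the parallelogram law, and
  closedness puts its limit in every \<open>K n\<close>.\<close>

lemma decreasing_convex_Inter_nonempty:
  fixes K :: "nat \<Rightarrow> 'a::{real_inner, complete_space} set"
  assumes closed: "\<And>n. closed (K n)" and convex: "\<And>n. convex (K n)" and ne: "\<And>n. K n \<noteq> {}"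
    and dec: "decseq K" and bdd: "bounded (K 0)"
  obtains z where "\<And>n. z \<in> K n"
proof -
  define d where "d n = infdist 0 (K n)" for n
  have d0: "0 \<le> d n" for n by (simp add: d_def infdist_nonneg)
  have d_le: "d n \<le> norm v" if "v \<in> K n" for v n
    using infdist_le[OF that, of 0] by (simp add: d_def)
  have "incseq d"
    unfolding d_def by (intro incseq_SucI infdist_mono) (use dec ne in \<open>auto simp: decseq_Suc_iff\<close>)
  obtain R where R: "\<And>v. v \<in> K 0 \<Longrightarrow> norm v \<le> R" using bdd by (auto simp: bounded_iff)
  have d_R: "d n \<le> R" for n
  proof -
    obtain v where "v \<in> K n" using ne by blast
    moreover have "v \<in> K 0" using \<open>v \<in> K n\<close> decseqD[OF dec, of 0 n] by auto
    ultimately show ?thesis using d_le R by (meson order_trans)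
  qed
  obtain D where D: "d \<longlonglongrightarrow> D" using incseq_convergent[OF \<open>incseq d\<close>] d_R by metis
  have "\<exists>v\<in>K n. norm v < d n + inverse (Suc n)" for n
    using cInf_lessD[of "dist 0 ` K n" "d n + inverse (Suc n)"] ne[of n]
    by (auto simp: d_def infdist_notempty)
  then obtain p where p: "\<And>n. p n \<in> K n" "\<And>n. norm (p n) < d n + inverse (Suc n)" by metis
  \<comment> \<open>\<open>q n\<close> bounds the squared norm of \<open>p n\<close> and has the
    same limit as the squared distance, so the bound in \<open>near\<close> tends to 0.\<close>
  define q where "q n = (d n + inverse (Suc n))\<^sup>2" for n
  have q: "q \<longlonglongrightarrow> D\<^sup>2"
    unfolding q_def using tendsto_power[OF tendsto_add[OF D LIMSEQ_inverse_real_of_nat]] by simp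
  have d2: "(\<lambda>n. (d n)\<^sup>2) \<longlonglongrightarrow> D\<^sup>2" by (rule tendsto_power[OF D])
  have near: "(norm (p n - p m))\<^sup>2 \<le> 2 * q n + 2 * q m - 4 * (d n)\<^sup>2" if "n \<le> m" for n m
  proof -
    \<comment> \<open>For \<open>n \<le> m\<close> both points lie in \<open>K n\<close>, hence so
      does their midpoint, whose norm is at least \<open>d n\<close>.\<close>
    have "p m \<in> K n" using p(1)[of m] decseqD[OF dec that] by auto
    then have "(1/2) *\<^sub>R p n + (1/2) *\<^sub>R p m \<in> K n"
      by (intro convexD[OF convex] p(1)) auto
    then have "d n \<le> norm ((1/2) *\<^sub>R (p n + p m))" by (metis d_le scaleR_add_right)
    then have "2 * d n \<le> norm (p n + p m)" by simp
    then have "(2 * d n)\<^sup>2 \<le> (norm (p n + p m))\<^sup>2" using d0 by (intro power_mono) auto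
    moreover have "(norm (p i))\<^sup>2 \<le> q i" for i
      unfolding q_def using p(2)[of i] by (intro power_mono) auto
    from this[of n] this[of m]
    have "(norm (p n))\<^sup>2 + (norm (p m))\<^sup>2 \<le> q n + q m" by simp
    moreover have "(norm (p n - p m))\<^sup>2 + (norm (p n + p m))\<^sup>2 = 2 * ((norm (p n))\<^sup>2 + (norm (p m))\<^sup>2)"
      by (simp add: power2_norm_eq_inner algebra_simps inner_commute)
    ultimately show ?thesis by (simp add: power_mult_distrib)
  qed
  have "Cauchy p"
  proof (rule CauchyI')
    fix e :: real assume "e > 0"
    \<comment> \<open>With \<open>q\<close> below the limit plus \<epsilon> and the squared distance
      above the limit minus \<epsilon>, the bound in \<open>near\<close> is less than 4 + 4 = 8
      times \<epsilon>.\<close>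
    define \<epsilon> where "\<epsilon> = e\<^sup>2 / 16"
    have "\<epsilon> > 0" using \<open>e > 0\<close> by (simp add: \<epsilon>_def)
    have "eventually (\<lambda>n. q n < D\<^sup>2 + \<epsilon> \<and> (d n)\<^sup>2 > D\<^sup>2 - \<epsilon>) sequentially"
      using order_tendstoD(2)[OF q, of "D\<^sup>2 + \<epsilon>"] order_tendstoD(1)[OF d2, of "D\<^sup>2 - \<epsilon>"] \<open>\<epsilon> > 0\<close>
      by (simp add: eventually_conj_iff)
    then obtain N where N: "\<And>n. n \<ge> N \<Longrightarrow> q n < D\<^sup>2 + \<epsilon> \<and> (d n)\<^sup>2 > D\<^sup>2 - \<epsilon>"
      by (auto simp: eventually_sequentially)
    have "dist (p m) (p n) < e" if "m \<ge> N" "m < n" for m n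
    proof -
      have "(norm (p m - p n))\<^sup>2 < 8 * \<epsilon>"
        using near[of m n] N[of m] N[of n] that by simp
      also have "\<dots> \<le> e\<^sup>2" by (simp add: \<epsilon>_def)
      finally show ?thesis using \<open>e > 0\<close> by (simp add: dist_norm power2_less_imp_less)
    qed
    then show "\<exists>M. \<forall>m\<ge>M. \<forall>n>m. dist (p m) (p n) < e" by blast
  qed
  then obtain z where z: "p \<longlonglongrightarrow> z" using Cauchy_convergent convergent_def by blast
  have "z \<in> K n" for n
  proof (rule Lim_in_closed_set[OF closed _ _ z])
    show "eventually (\<lambda>m. p m \<in> K n) sequentially"
      using p(1) decseqD[OF dec] by (intro eventually_sequentiallyI[of n]) blast
  qed simp
  then show thesis by (rule that)
qed

text \<open>These hulls take the place of weak closures of tails: a closed half-space containing a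
  tail contains its hull. A point common to all hulls is therefore the candidate for a weak
  limit.\<close>

definition tail_hull :: "(nat \<Rightarrow> 'a::real_normed_vector) \<Rightarrow> nat \<Rightarrow> 'a set" where
  "tail_hull y n = closure (convex hull (y ` {n..}))"

lemma tail_hull_subset:
  assumes "closed C" "convex C" "\<And>m. m \<ge> n \<Longrightarrow> y m \<in> C"
  shows "tail_hull y n \<subseteq> C"
  unfolding tail_hull_def using assms by (intro closure_minimal hull_minimal) auto

lemma tail_hull_ge:
  fixes f :: "'a::real_normed_vector \<Rightarrow> real"
  assumes f: "bounded_linear f" and ge: "\<And>m. m \<ge> n \<Longrightarrow> c \<le> f (y m)" and "z \<in> tail_hull y n"
  shows "c \<le> f z"
proof -
  have "closed {v. c \<le> f v}"
    by (intro closed_Collect_le continuous_intros linear_continuous_on f)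
  moreover have "convex {v. c \<le> f v}"
    using convex_linear_vimage[OF bounded_linear.linear[OF f], of "{c..}"]
    by (simp add: vimage_def)
  ultimately have "tail_hull y n \<subseteq> {v. c \<le> f v}"
    using ge by (intro tail_hull_subset) auto
  then show ?thesis using assms(3) by auto
qed

text \<open>A lower bound for \<open>f\<close> on a late tail passes to \<open>z\<close> by
  \<open>tail_hull_ge\<close>. Using this for \<open>f\<close> and for \<open>-f\<close> gives both
  inequalities.\<close>

lemma tail_hull_limit:
  fixes f :: "'a::real_normed_vector \<Rightarrow> real"
  assumes f: "bounded_linear f" and lim: "(\<lambda>n. f (y n)) \<longlonglongrightarrow> l" and z: "\<And>n. z \<in> tail_hull y n"
  shows "f z = l"
proof -
  have ge: "l' \<le> g z" if g: "bounded_linear g" and lim: "(\<lambda>n. g (y n)) \<longlonglongrightarrow> l'"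
    for g :: "'a \<Rightarrow> real" and l'
  proof (rule field_le_epsilon)
    fix e :: real assume "e > 0"
    then have "eventually (\<lambda>n. l' - e < g (y n)) sequentially"
      using order_tendstoD(1)[OF lim] by simp
    then obtain N where "\<And>n. n \<ge> N \<Longrightarrow> l' - e < g (y n)" by (auto simp: eventually_sequentially)
    then have "l' - e \<le> g z" using tail_hull_ge[OF g, of N "l' - e" y z] z by (simp add: less_imp_le)
    then show "l' \<le> g z + e" by simp
  qed
  have "l \<le> f z" using f lim by (rule ge)
  moreover have "- l \<le> - f z" by (rule ge[OF bounded_linear_minus[OF f] tendsto_minus[OF lim]])
  ultimately show ?thesis by simp
qed

lemma tail_hull_Inter_nonempty:
  fixes y :: "nat \<Rightarrow> 'a::{real_inner, complete_space}"
  assumes "bounded (range y)"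
  obtains z where "\<And>n. z \<in> tail_hull y n"
proof (rule decreasing_convex_Inter_nonempty)
  show "closed (tail_hull y n)" "convex (tail_hull y n)" "tail_hull y n \<noteq> {}" for n
    by (auto simp: tail_hull_def intro: convex_closure)
  show "decseq (tail_hull y)"
    unfolding decseq_def tail_hull_def by (auto intro!: closure_mono hull_mono)
  show "bounded (tail_hull y 0)"
  proof -
    obtain R where R: "\<And>m. norm (y m) \<le> R" using assms by (auto simp: bounded_iff)
    have "tail_hull y 0 \<subseteq> cball 0 R" by (rule tail_hull_subset) (use R in auto)
    then show ?thesis using bounded_cball bounded_subset by blast
  qed
qed (use that in blast)

(* A functional f failing to converge to f z would, along a subsequence, produce a second point z'
   of the closed hull with f z' \<noteq> f z. Both points have the same inner products with every y m,
   hence with every point of the hull, hence with z - z'. This avoids orthogonal projections and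
   the Riesz representation theorem. *)
lemma bounded_imp_weakly_convergent_subsequence:
  fixes x :: "nat \<Rightarrow> 'a::{real_inner, complete_space}"
  assumes "bounded (range x)"
  obtains l r where "strict_mono (r :: nat \<Rightarrow> nat)" "weakly_converges (x \<circ> r) l"
proof -
  obtain R where R: "\<And>n. norm (x n) \<le> R" using assms by (auto simp: bounded_iff)
  have bound: "norm (x n \<bullet> v) \<le> R * R" if "v \<in> range x" for n v
  proof -
    have "\<bar>x n \<bullet> v\<bar> \<le> norm (x n) * norm v" by (rule Cauchy_Schwarz_ineq2)
    also have "\<dots> \<le> R * R" using R that by (intro mult_mono) (auto intro: order_trans[OF norm_ge_zero])
    finally show ?thesis by simp
  qed
  \<comment> \<open>Diagonal extraction over the countable set \<open>range x\<close>: along one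
    subsequence the inner products with every member of the sequence converge.\<close>
  obtain r where r: "strict_mono (r :: nat \<Rightarrow> nat)"
    and conv: "\<And>v. v \<in> range x \<Longrightarrow> \<exists>l. (\<lambda>n. x (r n) \<bullet> v) \<longlonglongrightarrow> l"
    by (rule function_convergent_subsequence[of "range x" "\<lambda>n v. x n \<bullet> v" "R * R"])
      (simp, rule bound, assumption, blast)
  define y where "y = x \<circ> r"
  have bdd: "bounded (range (y \<circ> a))" for a :: "nat \<Rightarrow> nat"
    using R by (auto simp: y_def bounded_iff)
  obtain z where z: "\<And>n. z \<in> tail_hull y n"
    using tail_hull_Inter_nonempty[of y] bdd[of id] by auto
  \<comment> \<open>An upper estimate suffices: the lower one follows by applying it to
    \<open>-f\<close>.\<close>
  have ev: "eventually (\<lambda>n. f (y n) < f z + e) sequentially"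
    if f: "bounded_linear f" and "e > 0" for f :: "'a \<Rightarrow> real" and e
  proof (rule ccontr)
    assume "\<not> ?thesis"
    then have "infinite {n. f z + e \<le> f (y n)}"
      by (simp add: not_eventually not_less frequently_cofinite flip: cofinite_eq_sequentially)
    then obtain a where a: "strict_mono (a :: nat \<Rightarrow> nat)" "\<And>n. f z + e \<le> f (y (a n))"
      using infinite_enumerate[of "{n. f z + e \<le> f (y n)}"] by auto
    obtain z' where z': "\<And>n. z' \<in> tail_hull (y \<circ> a) n"
      using tail_hull_Inter_nonempty[OF bdd] by blast
    have "f z + e \<le> f z'"
      using tail_hull_ge[OF f _ z', of 0 "f z + e"] a(2) by simp
    have "tail_hull (y \<circ> a) 0 \<subseteq> tail_hull y 0"
      unfolding tail_hull_def by (auto intro!: closure_mono hull_mono)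
    then have z'0: "z' \<in> tail_hull y 0" using z' by blast
    have orth: "(z - z') \<bullet> y m = 0" for m
    proof -
      obtain l where l: "(\<lambda>n. y n \<bullet> y m) \<longlonglongrightarrow> l" using conv[of "y m"] by (auto simp: y_def)
      have "z \<bullet> y m = l"
        using bounded_linear_inner_left l z by (rule tail_hull_limit)
      moreover have "z' \<bullet> y m = l"
        using bounded_linear_inner_left _ z'
        by (rule tail_hull_limit) (use LIMSEQ_subseq_LIMSEQ[OF l a(1)] in \<open>simp add: o_def\<close>)
      ultimately show ?thesis by (simp add: inner_diff_left)
    qed
    have "tail_hull y 0 \<subseteq> {v. (z - z') \<bullet> v = 0}"
      by (rule tail_hull_subset) (use orth in \<open>auto simp: convex_hyperplane closed_hyperplane\<close>)
    then have "(z - z') \<bullet> z = 0" "(z - z') \<bullet> z' = 0" using z z'0 by blast+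
    then have "(z - z') \<bullet> (z - z') = 0" by (simp add: inner_diff_right)
    then have "z = z'" by simp
    then show False using \<open>f z + e \<le> f z'\<close> \<open>e > 0\<close> by simp
  qed
  have "weakly_converges y z"
    unfolding weakly_converges_def
  proof (intro allI impI tendstoI)
    fix f :: "'a \<Rightarrow> real" and e :: real assume f: "bounded_linear f" and "e > 0"
    show "eventually (\<lambda>n. dist (f (y n)) (f z) < e) sequentially"
      using ev[OF f \<open>e > 0\<close>] ev[OF bounded_linear_minus[OF f] \<open>e > 0\<close>]
      by eventually_elim (simp add: dist_real_def abs_less_iff)
  qed
  with r show thesis using that by (simp add: y_def)
qed

section \<open>The BDF coefficients\<close>

text \<open>The terms with positive index sum to minus the harmonic number that defines the
  coefficient at 0. Raising \<open>k\<close> by one changes their sum by an alternating binomial sum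
  divided by \<open>k + 1\<close>, that is, by \<open>-1 / (k + 1)\<close>.\<close>

lemma sum_bdf_delta: "(\<Sum>j\<le>k. bdf_delta k j) = 0"
proof -
  have "(\<Sum>i=1..k. (-1) ^ i / real i * real (k choose i)) = - (\<Sum>r=1..k. 1 / real r)" for k
  proof (induction k)
    case (Suc k)
    \<comment> \<open>Pascal's rule contributes the extra term
      \<open>(k choose (i - 1)) / i\<close>, which absorption turns into
      \<open>(Suc k choose i) / Suc k\<close>.\<close>
    have step: "(-1) ^ i / real i * real (Suc k choose i)
        = (-1) ^ i / real i * real (k choose i) + (-1) ^ i * real (Suc k choose i) / real (Suc k)"
      if "i \<in> {1..Suc k}" for i
    proof -
      obtain j where j: "i = Suc j" using \<open>i \<in> _\<close> by (cases i) auto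
      have "real (Suc j) * real (Suc k choose Suc j) = real (Suc k) * real (k choose j)"
        using binomial_absorption[of j "Suc k"] by (metis diff_Suc_1 of_nat_mult)
      then have "real (k choose j) / real (Suc j) = real (Suc k choose Suc j) / real (Suc k)"
        by (simp add: field_simps del: binomial_Suc_Suc of_nat_Suc)
      moreover have "real (Suc k choose Suc j) = real (k choose j) + real (k choose Suc j)" by simp
      ultimately have "real (Suc k choose Suc j) / real (Suc j)
          = real (k choose Suc j) / real (Suc j) + real (Suc k choose Suc j) / real (Suc k)"
        by (metis add.commute add_divide_distrib)
      then have "(-1) ^ i * (real (Suc k choose Suc j) / real (Suc j))
          = (-1) ^ i * (real (k choose Suc j) / real (Suc j) + real (Suc k choose Suc j) / real (Suc k))"
        by (rule arg_cong)
      then show ?thesis unfolding j by (simp only: distrib_left times_divide_eq_left times_divide_eq_right)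
    qed
    \<comment> \<open>The full alternating sum of the row vanishes, and its term at 0 is 1.\<close>
    have alt: "(\<Sum>i=1..Suc k. (-1) ^ i * real (Suc k choose i)) = -1"
    proof -
      have "(\<Sum>i\<le>Suc k. (-1) ^ i * real (Suc k choose i)) = 0"
        using choose_alternating_sum[of "Suc k", where 'a = real] by simp
      then show ?thesis
        by (simp add: atMost_atLeast0 sum.atLeast_Suc_atMost del: sum.cl_ivl_Suc binomial_Suc_Suc)
    qed
    have "(\<Sum>i=1..Suc k. (-1) ^ i / real i * real (Suc k choose i))
      = (\<Sum>i=1..Suc k. (-1) ^ i / real i * real (k choose i))
        + (\<Sum>i=1..Suc k. (-1) ^ i * real (Suc k choose i)) / real (Suc k)"
      unfolding sum_divide_distrib sum.distrib[symmetric] by (rule sum.cong[OF refl step])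
    also have "\<dots> = - (\<Sum>r=1..Suc k. 1 / real r)"
      unfolding alt using Suc.IH by simp
    finally show ?case .
  qed simp
  then show ?thesis
    by (simp add: atMost_atLeast0 sum.atLeast_Suc_atMost bdf_delta_def del: sum.cl_ivl_Suc)
qed

text \<open>Abel summation; for the BDF coefficients the boundary term vanishes by
  \<open>sum_bdf_delta\<close>.\<close>

lemma sum_parts_shift:
  fixes v :: "nat \<Rightarrow> 'a::real_vector"
  shows "(\<Sum>j\<le>k. d j *\<^sub>R v j)
    = (\<Sum>j<k. (\<Sum>l\<le>j. d l) *\<^sub>R (v j - v (Suc j))) + (\<Sum>l\<le>k. d l) *\<^sub>R v k"
proof (induction k)
  case (Suc k)
  then show ?case by (simp add: scaleR_right_diff_distrib scaleR_left_distrib)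
qed simp

lemma bdf_tilde_diff:
  assumes "n \<ge> 1" "s \<noteq> 0"
  shows "bdf_tilde k u n - bdf_tilde k u (n - 1) = s *\<^sub>R bdf_dot k s u n"
proof -
  have "s *\<^sub>R bdf_dot k s u n = (\<Sum>j\<le>k. bdf_delta k j *\<^sub>R u (n - j))"
    using assms by (simp add: bdf_dot_def atMost_atLeast0)
  also have "\<dots> = (\<Sum>j<k. bdf_delta_tilde k j *\<^sub>R (u (n - j) - u (n - Suc j)))"
    by (simp add: sum_parts_shift sum_bdf_delta bdf_delta_tilde_def)
  also have "\<dots> = bdf_tilde k u n - bdf_tilde k u (n - 1)"
    by (simp add: bdf_tilde_def scaleR_diff_right sum_subtractf)
  finally show ?thesis ..
qed

section \<open>Energy decay\<close>

lemma bdf_step_energy: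
  fixes u :: "nat \<Rightarrow> 'u::real_inner"
  assumes step: "bdf_step U0 B M \<alpha> s k u n"
    and M: "bilinear M" "\<And>v w. M v w = M w v"
    and coercive: "\<And>v. C * (norm v)\<^sup>2 \<le> M v v"
    and pos: "\<alpha> \<ge> 0" "s > 0" "n \<ge> 1"
  shows "(norm (bdf_dot k s u n))\<^sup>2 + M (bdf_tilde k u n) (bdf_tilde k u n)
      + C * s\<^sup>2 * (norm (bdf_dot k s u n))\<^sup>2
    \<le> (norm (bdf_dot k s u (n - 1)))\<^sup>2 + M (bdf_tilde k u (n - 1)) (bdf_tilde k u (n - 1))"
proof -
  define a b t t' where "a = bdf_dot k s u n" and "b = bdf_dot k s u (n - 1)"
    and "t = bdf_tilde k u n" and "t' = bdf_tilde k u (n - 1)"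
  have "(1 / s) * ((a - b) \<bullet> a) + \<alpha> / (real n * s) * (a \<bullet> a) + M t a = 0"
    using step by (auto simp: bdf_step_def a_def b_def t_def)
  then have "s * ((1 / s) * ((a - b) \<bullet> a) + \<alpha> / (real n * s) * (a \<bullet> a) + M t a) = 0" by simp
  then have "(a - b) \<bullet> a + \<alpha> / real n * (a \<bullet> a) + s * M t a = 0"
    using pos by (simp add: distrib_left)
  moreover have "0 \<le> \<alpha> / real n * (a \<bullet> a)" using pos by simp
  ultimately have "(a - b) \<bullet> a + M t (s *\<^sub>R a) \<le> 0"
    by (simp add: bilinear_rmul[OF M(1)])
  \<comment> \<open>The difference of the two sides is the squared norm of \<open>a - b\<close>,
    which is discarded. The analogous remainder for \<open>M\<close> below is kept: by coercivity it
    supplies the dissipation.\<close>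
  moreover have "(norm a)\<^sup>2 - (norm b)\<^sup>2 \<le> 2 * ((a - b) \<bullet> a)"
    using inner_ge_zero[of "a - b"]
    by (simp add: power2_norm_eq_inner inner_diff_left inner_diff_right inner_commute)
  moreover have sa: "s *\<^sub>R a = t - t'"
    using bdf_tilde_diff[of n s k u] pos by (simp add: a_def t_def t'_def)
  moreover have "2 * M t (s *\<^sub>R a) = M t t - M t' t' + M (s *\<^sub>R a) (s *\<^sub>R a)"
    unfolding sa using M(2)[of t t']
    by (simp add: bilinear_lsub[OF M(1)] bilinear_rsub[OF M(1)])
  moreover have "C * s\<^sup>2 * (norm a)\<^sup>2 \<le> M (s *\<^sub>R a) (s *\<^sub>R a)"
    using coercive[of "s *\<^sub>R a"] by (simp add: power_mult_distrib mult.assoc)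
  ultimately show ?thesis unfolding a_def b_def t_def t'_def by linarith
qed

text \<open>Telescoping the energy decay bounds the accumulated dissipation by the starting energy,
  so the squared norms are summable. The remaining energy bounds \<open>bdf_tilde\<close> by
  coercivity of \<open>M\<close>.\<close>

lemma bdf_dot_tendsto_0_and_tilde_bounded:
  fixes u :: "nat \<Rightarrow> 'u::real_inner"
  assumes step: "\<And>n. n \<ge> k \<Longrightarrow> bdf_step U0 B M \<alpha> s k u n" and "k \<ge> 1"
    and M: "bilinear M" "\<And>v w. M v w = M w v"
    and coercive: "\<And>v. C * (norm v)\<^sup>2 \<le> M v v" and "C > 0"
    and pos: "\<alpha> \<ge> 0" "s > 0"
  shows "(\<lambda>n. bdf_dot k s u n) \<longlonglongrightarrow> 0" and "\<exists>K. \<forall>n\<ge>k. norm (bdf_tilde k u n) \<le> K"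
proof -
  define a where "a n = (norm (bdf_dot k s u (n + k)))\<^sup>2" for n
  \<comment> \<open>The shift makes \<open>E 0\<close> the energy at index \<open>k - 1\<close>,
    just before the first step of full order; \<open>a n\<close> belongs to the step from
    \<open>E n\<close> to \<open>E (Suc n)\<close>.\<close>
  define E where "E n = (norm (bdf_dot k s u (n + k - 1)))\<^sup>2
    + M (bdf_tilde k u (n + k - 1)) (bdf_tilde k u (n + k - 1))" for n
  have M0: "0 \<le> M v v" for v
    using coercive[of v] \<open>C > 0\<close> by (meson mult_nonneg_nonneg less_imp_le order_trans zero_le_power2)
  have E0: "0 \<le> E n" for n unfolding E_def using M0 by simp
  have decay: "E (Suc n) + C * s\<^sup>2 * a n \<le> E n" for n
    using bdf_step_energy[OF step M coercive pos, of "n + k"] \<open>k \<ge> 1\<close> by (simp add: E_def a_def)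
  have sum: "E n + C * s\<^sup>2 * (\<Sum>i<n. a i) \<le> E 0" for n
  proof (induction n)
    case (Suc n)
    then show ?case using decay[of n] by (simp add: distrib_left)
  qed simp
  have "summable a"
  proof (rule summableI_nonneg_bounded)
    show "0 \<le> a n" for n by (simp add: a_def)
    show "(\<Sum>i<n. a i) \<le> E 0 / (C * s\<^sup>2)" for n
      using sum[of n] E0[of n] \<open>C > 0\<close> \<open>s > 0\<close> by (simp add: pos_le_divide_eq mult.commute)
  qed
  then have "a \<longlonglongrightarrow> 0" by (rule summable_LIMSEQ_zero)
  then have "(\<lambda>n. sqrt (a n)) \<longlonglongrightarrow> 0" using tendsto_real_sqrt by fastforce
  then have "(\<lambda>n. bdf_dot k s u (n + k)) \<longlonglongrightarrow> 0"
    by (simp add: a_def tendsto_norm_zero_iff)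
  then show "(\<lambda>n. bdf_dot k s u n) \<longlonglongrightarrow> 0" by (rule LIMSEQ_offset)
  have "norm (bdf_tilde k u n) \<le> sqrt (E 0 / C)" if "n \<ge> k" for n
  proof -
    have "C * (norm (bdf_tilde k u n))\<^sup>2 \<le> E (n - k + 1)"
      using coercive[of "bdf_tilde k u n"] that \<open>k \<ge> 1\<close>
      by (simp add: E_def add.commute order_trans[OF coercive])
    also have "\<dots> \<le> E 0"
    proof -
      have "0 \<le> C * s\<^sup>2 * (\<Sum>i<n-k+1. a i)" 
        using \<open>C > 0\<close> by (intro mult_nonneg_nonneg sum_nonneg) (auto simp: a_def)
      then show ?thesis using sum[of "n - k + 1"] by linarith
    qed
    finally show ?thesis using \<open>C > 0\<close> by (intro real_le_rsqrt) (simp add: field_simps)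
  qed
  then show "\<exists>K. \<forall>n\<ge>k. norm (bdf_tilde k u n) \<le> K" by blast
qed

section \<open>Boundedness of the iterates for orders two to four\<close>

lemma bounded_if_contractive_recursion:
  fixes u :: "nat \<Rightarrow> 'a::real_normed_vector"
  assumes rec: "\<And>n R. n \<ge> N \<Longrightarrow> (\<And>m. m < n \<Longrightarrow> norm (u m) \<le> R) \<Longrightarrow> norm (u n) \<le> K + \<theta> * R"
    and "\<theta> < 1"
  shows "bounded (range u)"
proof -
  \<comment> \<open>The first entry is the fixed point of
    \<open>R \<mapsto> K + \<theta> * R\<close>; the second dominates the values before the
    recursion starts.\<close>
  define R where "R = max (K / (1 - \<theta>)) (\<Sum>m<N. norm (u m))"
  have fix_R: "K + \<theta> * R \<le> R"
  proof -
    have "K / (1 - \<theta>) \<le> R" by (simp add: R_def)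
    then show ?thesis using \<open>\<theta> < 1\<close> by (simp add: pos_divide_le_eq algebra_simps)
  qed
  have "norm (u n) \<le> R" for n
  proof (induction n rule: less_induct)
    case (less n)
    show ?case
    proof (cases "n < N")
      case True
      then have "norm (u n) \<le> (\<Sum>m<N. norm (u m))" by (intro member_le_sum) auto
      then show ?thesis by (simp add: R_def)
    next
      case False
      then show ?thesis using rec[of n R] less fix_R by fastforce
    qed
  qed
  then show ?thesis by (auto simp: bounded_iff)
qed

lemma bdf_tilde_2: "bdf_tilde 2 u n = (3/2) *\<^sub>R u n - (1/2) *\<^sub>R u (n - 1)"
  by (simp add: bdf_tilde_def bdf_delta_tilde_def bdf_delta_def numeral_eq_Suc)

lemma choose_numerals: "(3::nat) choose 2 = 3" "(4::nat) choose 2 = 6" "(4::nat) choose 3 = 4"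
  by (simp_all add: numeral_eq_Suc)

lemma bdf_delta_3: "bdf_delta 3 0 = 11/6" "bdf_delta 3 (Suc 0) = -3" "bdf_delta 3 2 = 3/2"
  by (simp_all add: bdf_delta_def choose_numerals) (simp add: eval_nat_numeral)

lemma bdf_delta_4: "bdf_delta 4 0 = 25/12" "bdf_delta 4 (Suc 0) = -4" "bdf_delta 4 2 = 3" "bdf_delta 4 3 = -4/3"
  by (simp_all add: bdf_delta_def choose_numerals) (simp add: eval_nat_numeral)

lemma bdf_tilde_3:
  "bdf_tilde 3 u n = (11/6) *\<^sub>R u n - (7/6) *\<^sub>R u (n - 1) + (1/3) *\<^sub>R u (n - 2)"
  by (simp add: bdf_tilde_def bdf_delta_tilde_def lessThan_nat_numeral atMost_nat_numeral
      lessThan_Suc atMost_Suc bdf_delta_3)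

lemma bdf_tilde_4:
  "bdf_tilde 4 u n = (25/12) *\<^sub>R u n - (23/12) *\<^sub>R u (n - 1) + (13/12) *\<^sub>R u (n - 2) - (1/4) *\<^sub>R u (n - 3)"
  by (simp add: bdf_tilde_def bdf_delta_tilde_def lessThan_nat_numeral atMost_nat_numeral
      lessThan_Suc atMost_Suc bdf_delta_4)

text \<open>Solving for \<open>u n\<close> leaves earlier iterates whose coefficients have absolute
  sum 1/3 for order 2 and 9/11 for order 3. For order 4, combining two consecutive averages brings
  this sum down to 17/25.\<close>

lemma bounded_if_bdf_tilde_bounded:
  fixes u :: "nat \<Rightarrow> 'a::real_normed_vector"
  assumes k: "2 \<le> k" "k \<le> 4" and K: "\<And>n. n \<ge> k \<Longrightarrow> norm (bdf_tilde k u n) \<le> K"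
  shows "bounded (range u)"
proof -
  have sc: "norm (c *\<^sub>R v) \<le> \<bar>c\<bar> * r" if "norm v \<le> r" for c r and v :: 'a
    using that by (simp add: mult_left_mono)
  consider "k = 2" | "k = 3" | "k = 4" using k by linarith
  then show ?thesis
  proof cases
    case 1
    show ?thesis
    proof (rule bounded_if_contractive_recursion)
      fix n R assume n: "n \<ge> (2::nat)" and R: "\<And>m. m < n \<Longrightarrow> norm (u m) \<le> R"
      have "u n = (2/3) *\<^sub>R bdf_tilde 2 u n + (1/3) *\<^sub>R u (n - 1)"
        by (simp add: bdf_tilde_2 algebra_simps)
      also have "norm \<dots> \<le> \<bar>2/3\<bar> * K + \<bar>1/3\<bar> * R"
        by (intro norm_triangle_mono sc R) (use n K[of n] 1 in auto)
      finally show "norm (u n) \<le> 2/3 * K + 1/3 * R" by simp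
    qed simp
  next
    case 2
    show ?thesis
    proof (rule bounded_if_contractive_recursion)
      fix n R assume n: "n \<ge> (3::nat)" and R: "\<And>m. m < n \<Longrightarrow> norm (u m) \<le> R"
      have "u n = (6/11) *\<^sub>R bdf_tilde 3 u n + (7/11) *\<^sub>R u (n - 1) + (- 2/11) *\<^sub>R u (n - 2)"
        by (simp add: bdf_tilde_3 algebra_simps)
      also have "norm \<dots> \<le> \<bar>6/11\<bar> * K + \<bar>7/11\<bar> * R + \<bar>- 2/11\<bar> * R"
        by (intro norm_triangle_mono sc R) (use n K[of n] 2 in auto)
      finally show "norm (u n) \<le> 6/11 * K + 9/11 * R" by simp
    qed simp
  next
    case 3
    (* The leading coefficient of 25 - 23 z + 13 z^2 - 3 z^3 does not dominate the others, but
       multiplication by 1 + z/2 gives 25 - 21/2 z + 3/2 z^2 + 7/2 z^3 - 3/2 z^4, where it does. *)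
    show ?thesis
    proof (rule bounded_if_contractive_recursion)
      \<comment> \<open>The recursion starts at 5 because it also uses the average at
        \<open>n - 1\<close>, which is bounded from index 4 on.\<close>
      fix n R assume n: "n \<ge> (5::nat)" and R: "\<And>m. m < n \<Longrightarrow> norm (u m) \<le> R"
      have K4: "norm (bdf_tilde 4 u m) \<le> K" if "m \<ge> 4" for m using K[of m] 3 that by simp
      have idx: "n - 1 - 1 = n - 2" "n - 1 - 2 = n - 3" "n - 1 - 3 = n - 4" by auto
      \<comment> \<open>These splittings make the contributions of the two averages and the explicit
        terms cancel at \<open>n - 1\<close>, \<open>n - 2\<close> and \<open>n - 3\<close>.\<close>
      have coeffs: "(23/25) *\<^sub>R v = (1/2) *\<^sub>R v + (21/50) *\<^sub>R v"
        "(13/25) *\<^sub>R v = (3/50) *\<^sub>R v + (23/50) *\<^sub>R v"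
        "(13/50) *\<^sub>R v = (3/25) *\<^sub>R v + (7/50) *\<^sub>R v" for v :: 'a
        by (simp_all flip: scaleR_left_distrib)
      have eq: "u n = (12/25) *\<^sub>R bdf_tilde 4 u n + (6/25) *\<^sub>R bdf_tilde 4 u (n - 1)
          + (21/50) *\<^sub>R u (n - 1) + (- 3/50) *\<^sub>R u (n - 2) + (- 7/50) *\<^sub>R u (n - 3) + (3/50) *\<^sub>R u (n - 4)"
        unfolding bdf_tilde_4 idx by (simp add: coeffs algebra_simps)
      have "norm (u n) \<le> \<bar>12/25\<bar> * K + \<bar>6/25\<bar> * K + \<bar>21/50\<bar> * R + \<bar>- 3/50\<bar> * R
          + \<bar>- 7/50\<bar> * R + \<bar>3/50\<bar> * R"
        by (subst eq, intro norm_triangle_mono sc R K4) (use n in simp_all)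
      then show "norm (u n) \<le> 18/25 * K + 17/25 * R" by simp
    qed simp
  qed
qed

theorem corollary5p2:
  fixes \<Omega> \<Gamma>\<^sub>D :: "(real ^ 'd) set"
    and ev\<^sub>U :: "'u::{real_inner, complete_space} \<Rightarrow> real ^ 'd \<Rightarrow> real ^ 'm"
    and ev\<^sub>Z :: "'z::real_normed_vector \<Rightarrow> real ^ 'd \<Rightarrow> 'q::euclidean_space"
    and T :: "'u \<Rightarrow> 'g::real_normed_vector" and g\<^sub>D :: 'g
    and U\<^sub>D U\<^sub>0 :: "'u set"
    and B :: "'u \<Rightarrow> 'u \<Rightarrow> 'z" and c\<^sub>Z :: real and u\<^sub>c :: 'z
    and M :: "'u \<Rightarrow> 'u \<Rightarrow> real" and C\<^sub>1 C\<^sub>2 :: real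
    and \<alpha> s :: real and k :: nat and u :: "nat \<Rightarrow> 'u"
  assumes "bounded_lipschitz_domain \<Omega>" and "\<Gamma>\<^sub>D \<subseteq> frontier \<Omega>"
    and "function_space_on \<Omega> ev\<^sub>U" and "continuously_embedded_H1 \<Omega> ev\<^sub>U"
    and "function_space_on \<Omega> ev\<^sub>Z"
    and "dirichlet_operator \<Omega> \<Gamma>\<^sub>D ev\<^sub>U T"
    and "U\<^sub>D = {v. T v = g\<^sub>D}" and "U\<^sub>0 = {v. T v = 0}"
    and "bilinear B" and "\<And>v w. B v w = B w v"
    and "\<And>v. norm (B v v) \<le> c\<^sub>Z * (norm v)\<^sup>2"
    and "bilinear M" and "\<And>v w. M v w = M w v"
    and "C\<^sub>1 > 0" and "C\<^sub>2 > 0"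
    and "\<And>v. M v v \<ge> C\<^sub>1 * (norm v)\<^sup>2"
    and "\<And>v w. M v w \<le> C\<^sub>2 * norm v * norm w"
    and "\<alpha> \<ge> 3" and "s > 0" and "k \<ge> 1"
    and "bdf_sequence U\<^sub>D U\<^sub>0 B u\<^sub>c M \<alpha> s k u"
  shows "(\<lambda>n. bdf_dot k s u n) \<longlonglongrightarrow> 0 \<and>
    (2 \<le> k \<and> k \<le> 4 \<longrightarrow>
      (\<exists>u_star r. strict_mono (r :: nat \<Rightarrow> nat) \<and> weakly_converges (u \<circ> r) u_star))"
proof (intro conjI impI)
  have step: "\<And>n. n \<ge> k \<Longrightarrow> bdf_step U\<^sub>0 B M \<alpha> s k u n"
    using \<open>bdf_sequence U\<^sub>D U\<^sub>0 B u\<^sub>c M \<alpha> s k u\<close> by (simp add: bdf_sequence_def)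
  have "\<alpha> \<ge> 0" using \<open>\<alpha> \<ge> 3\<close> by simp
  note energy = bdf_dot_tendsto_0_and_tilde_bounded[OF step \<open>k \<ge> 1\<close> \<open>bilinear M\<close>
      \<open>\<And>v w. M v w = M w v\<close> \<open>\<And>v. M v v \<ge> C\<^sub>1 * (norm v)\<^sup>2\<close> \<open>C\<^sub>1 > 0\<close> \<open>\<alpha> \<ge> 0\<close> \<open>s > 0\<close>]
  show "(\<lambda>n. bdf_dot k s u n) \<longlonglongrightarrow> 0" by (rule energy(1))
  assume k: "2 \<le> k \<and> k \<le> 4"
  obtain K where "\<And>n. n \<ge> k \<Longrightarrow> norm (bdf_tilde k u n) \<le> K" using energy(2) by blast
  then have "bounded (range u)" using bounded_if_bdf_tilde_bounded k by blast
  then show "\<exists>u_star r. strict_mono (r :: nat \<Rightarrow> nat) \<and> weakly_converges (u \<circ> r) u_star"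
    using bounded_imp_weakly_convergent_subsequence by blast
qed

end
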